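(* Let $W$ be a weight matrix, i.e. a $v\times v$ symmetric non-negative definite matrix with $\mathcal{C}(W)\subseteq\mathcal{E}$. Then the matrix $W$ corresponds to the system of estimable functions $W^{1/2}\tau$ (that is, $W^{1/2}\tau$ is a system of estimable functions and $W$ is its corresponding weight matrix). Moreover, given a design $\xi$ that is feasible for $W^{1/2}\tau$, the weighted information matrix $C_W(\xi)=(K_W^TC^-(\xi)K_W)^{-1}$ has the same eigenvalues (including multiplicities) as the information matrix $N_{W^{1/2}}(\xi)=(W^{1/2}C^-(\xi)W^{1/2})^+$ for $W^{1/2}\tau$.
   Context: Consider the linear model $y=X(\xi)\tau+L\beta+\varepsilon$, where $y\in\mathbb{R}^n$ is the response, $\tau\in\mathbb{R}^v$ is the vector of parameters of interest, $\beta\in\mathbb{R}^m$ is the vector of nuisance parameters, $\varepsilon$ satisfies $E(\varepsilon)=0$ and $\mathrm{Var}(\varepsilon)=I_n$, the design $\xi$ determines the matrix $X(\xi)$, and $L$ does not depend on $\xi$. The information matrix of $\xi$ for $\tau$ is the $v\times v$ non-negative definite matrix $C(\xi)=X^T(\xi)(I-P_L)X(\xi)$, where $P_L=L(L^TL)^-L^T$ is the orthogonal projector on the column space of $L$. Write $\mathcal{C}(A)$ for the column space of $A$, $A^+$ for the Moore-Penrose inverse, $A^-$ for any generalized inverse ($AA^-A=A$), $C^-(\xi)$ for a generalized inverse of $C(\xi)$, and $W^{1/2}$ for the non-negative definite square root of $W$. A function $q^T\tau$ is estimable under $\xi$ if and only if $q\in\mathcal{C}(C(\xi))$. Standing assumption: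 all competing designs $\xi$ have the same estimation space, i.e. there is a fixed subspace $\mathcal{E}\subseteq\mathbb{R}^v$ with $\mathcal{C}(C(\xi))=\mathcal{E}$ for every competing $\xi$. A system $Q^T\tau$ (with $Q$ a matrix with $v$ rows) is a system of estimable functions if $\mathcal{C}(Q)\subseteq\mathcal{E}$; its corresponding (unscaled) weight matrix is $QQ^T$; a design $\xi$ is feasible for $Q^T\tau$ if $Q^T\tau$ is estimable under $\xi$, i.e. $\mathcal{C}(Q)\subseteq\mathcal{C}(C(\xi))$; the information matrix of $\xi$ for $Q^T\tau$ is $N_Q(\xi)=(Q^TC^-(\xi)Q)^+$. For a weight matrix $W$ of rank $d$ with spectral decomposition $W=S_W\Lambda_WS_W^T$, where $\Lambda_W=\mathrm{diag}(\lambda_1(W),\ldots,\lambda_v(W))$ with $\lambda_1(W)\ge\ldots\ge\lambda_v(W)$ and $S_W$ is orthogonal, put $K_W=FD^{1/2}$, where $D=\mathrm{diag}(\lambda_1(W),\ldots,\lambda_d(W))$ contains the positive eigenvalues of $W$ and $F$ consists of the first $d$ columns of $S_W$. Thus $K_W$ is a $v\times d$ matrix of rank $d$ with $K_WK_W^T=W$. The weighted information matrix $C_W(\xi)=(K_W^TC^-(\xi)K_W)^{-1}$ is defined for designs $\xi$ with $\mathcal{C}(W)\subseteq\mathcal{C}(C(\xi))$.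
   Formalization: C_W(ξ) is d×d and N_{W^{1/2}}(ξ) is v×v (d = rank W), so their eigenvalues cannot literally coincide when d < v; the proved claim is that the eigenvalues of N_{W^{1/2}}(ξ) are those of C_W(ξ), all nonzero, together with exactly v−d zeros. *)

theory Defs
  imports
    Complex_Main
    "Jordan_Normal_Form.DL_Rank"
    "Jordan_Normal_Form.Char_Poly"
    "Jordan_Normal_Form.Gauss_Jordan_Elimination"
begin

abbreviation column_space :: "real mat \<Rightarrow> real vec set" where
  "column_space A \<equiv> vec_space.col_space (dim_row A) A"

definition is_generalized_inverse :: "real mat \<Rightarrow> real mat \<Rightarrow> bool" where
  "is_generalized_inverse A G \<longleftrightarrow>
     G \<in> carrier_mat (dim_col A) (dim_row A) \<and> A * G * A = A"

definition is_mp_inverse :: "real mat \<Rightarrow> real mat \<Rightarrow> bool" where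
  "is_mp_inverse A B \<longleftrightarrow>
     B \<in> carrier_mat (dim_col A) (dim_row A) \<and>
     A * B * A = A \<and> B * A * B = B \<and> (A * B)\<^sup>T = A * B \<and> (B * A)\<^sup>T = B * A"

definition mp_inverse :: "real mat \<Rightarrow> real mat" where
  "mp_inverse A = (THE B. is_mp_inverse A B)"

definition nonneg_definite :: "nat \<Rightarrow> real mat \<Rightarrow> bool" where
  "nonneg_definite k A \<longleftrightarrow>
     A \<in> carrier_mat k k \<and> A\<^sup>T = A \<and> (\<forall>x \<in> carrier_vec k. 0 \<le> x \<bullet> (A *\<^sub>v x))"

text \<open>The non-negative definite square root, which exists and is unique for non-negative definite \<open>A\<close>;
  for other arguments the value is unspecified.\<close>

definition mat_sqrt :: "real mat \<Rightarrow> real mat" where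
  "mat_sqrt A = (THE R. nonneg_definite (dim_row A) R \<and> R * R = A)"

text \<open>Eigenvalues with algebraic multiplicity. They are taken over the complex numbers, so that a
  matrix of size k always has exactly k of them.\<close>

definition eigenvalue_mset :: "real mat \<Rightarrow> complex multiset" where
  "eigenvalue_mset A = proots (char_poly (map_mat complex_of_real A))"

text \<open>The argument \<open>GL\<close> is a generalized inverse of \<open>L\<^sup>T * L\<close>; the projector does not depend on
  its choice.\<close>

definition projector :: "real mat \<Rightarrow> real mat \<Rightarrow> real mat" where
  "projector L GL = L * GL * L\<^sup>T"

definition info_matrix :: "real mat \<Rightarrow> real mat \<Rightarrow> real mat \<Rightarrow> real mat" where
  "info_matrix L GL X = X\<^sup>T * (1\<^sub>m (dim_row L) - projector L GL) * X"

text \<open>In the next three definitions a system of functions of \<open>\<tau>\<close> is given by its coefficient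
  matrix \<open>Q\<close>, that is, the system is \<open>Q\<^sup>T \<tau>\<close>. The set \<open>E\<close> is the estimation space, and \<open>C\<close> is the
  information matrix of a design for \<open>\<tau>\<close>.\<close>

definition estimable_system :: "nat \<Rightarrow> real vec set \<Rightarrow> real mat \<Rightarrow> bool" where
  "estimable_system v E Q \<longleftrightarrow> dim_row Q = v \<and> column_space Q \<subseteq> E"

definition corresponding_weight_matrix :: "real mat \<Rightarrow> real mat" where
  "corresponding_weight_matrix Q = Q * Q\<^sup>T"

definition feasible :: "real mat \<Rightarrow> real mat \<Rightarrow> bool" where
  "feasible C Q \<longleftrightarrow> dim_row Q = dim_row C \<and> column_space Q \<subseteq> column_space C"

definition is_weight_matrix :: "nat \<Rightarrow> real vec set \<Rightarrow> real mat \<Rightarrow> bool" where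
  "is_weight_matrix v E W \<longleftrightarrow> nonneg_definite v W \<and> column_space W \<subseteq> E"

definition mat_rank :: "real mat \<Rightarrow> nat" where
  "mat_rank A = vec_space.rank (dim_row A) A"

text \<open>\<open>S\<close> is orthogonal and \<open>lam 0 \<ge> lam 1 \<ge> \<dots>\<close> lists the eigenvalues (0-based indices). Neither
  \<open>S\<close> nor, therefore, the matrix \<open>weight_factor\<close> below is unique.\<close>

definition spectral_decomposition :: "real mat \<Rightarrow> real mat \<Rightarrow> (nat \<Rightarrow> real) \<Rightarrow> bool" where
  "spectral_decomposition W S lam \<longleftrightarrow>
     (let k = dim_row W in
        S \<in> carrier_mat k k \<and> inverts_mat S S\<^sup>T \<and> inverts_mat S\<^sup>T S \<and>
        (\<forall>i j. i \<le> j \<longrightarrow> j < k \<longrightarrow> lam j \<le> lam i) \<and>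
        W = S * mat_diag k lam * S\<^sup>T)"

definition weight_factor :: "real mat \<Rightarrow> real mat \<Rightarrow> (nat \<Rightarrow> real) \<Rightarrow> real mat" where
  "weight_factor W S lam =
     (let d = mat_rank W in
        mat_of_cols (dim_row W) (take d (cols S)) * mat_sqrt (mat_diag d lam))"

text \<open>In the following, \<open>G\<close> is a generalized inverse of the information matrix of the design
  for \<open>\<tau>\<close>. The weighted information matrix is meaningful only if \<open>K\<^sup>T * G * K\<close> is invertible.\<close>

definition weighted_info_matrix :: "real mat \<Rightarrow> real mat \<Rightarrow> real mat" where
  "weighted_info_matrix K G = the (mat_inverse (K\<^sup>T * G * K))"

definition system_info_matrix :: "real mat \<Rightarrow> real mat \<Rightarrow> real mat" where
  "system_info_matrix Q G = mp_inverse (Q\<^sup>T * G * Q)"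

end

theory Submission
  imports Defs "Jordan_Normal_Form.Schur_Decomposition"
begin

text \<open>
  Write \<open>C = B\<^sup>T B\<close> for the information matrix and \<open>R\<close> for the square root of \<open>W\<close>. If \<open>F\<close> collects the
  first \<open>d = rank W\<close> columns of \<open>S\<close>, then \<open>F\<^sup>T F = I\<close> and \<open>R = K F\<^sup>T\<close>. Since \<open>R = C Z\<close> for some \<open>Z\<close>, the
  matrix \<open>R C\<^sup>- R = Z\<^sup>T C Z\<close> does not depend on the generalized inverse, so it equals \<open>F M F\<^sup>T\<close> with
  \<open>M = K\<^sup>T C\<^sup>- K\<close>. Moreover \<open>K = C Y\<close> for \<open>Y = Z F\<close>, hence \<open>M = (B Y)\<^sup>T (B Y)\<close>, and \<open>M x = 0\<close> forces
  \<open>K x = B\<^sup>T (B Y x) = 0\<close>, hence \<open>x = 0\<close>: \<open>M\<close> is invertible. As \<open>F\<close> has orthonormal columns, the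
  Moore-Penrose inverse of \<open>F M F\<^sup>T\<close> is \<open>F M\<^sup>-\<^sup>1 F\<^sup>T\<close>, which is orthogonally similar, via \<open>S\<close>, to
  \<open>M\<^sup>-\<^sup>1\<close> padded with \<open>v - d\<close> zero rows and columns.
\<close>

section \<open>Diagonalization of symmetric matrices\<close>

text \<open>Over the complex numbers the characteristic polynomial has a root \<open>k\<close>, with
  an eigenvector \<open>w\<close>. Since \<open>A\<close> is real and symmetric, moving it across
  the product of \<open>w\<close> with its conjugate gives \<open>k = cnj k\<close>, so
  \<open>k\<close> is real.\<close>

lemma symmetric_eigenvector:
  fixes A :: "real mat"
  assumes A: "A \<in> carrier_mat n n" and sym: "A\<^sup>T = A" and n: "n \<noteq> 0"
  obtains e v where "v \<in> carrier_vec n" "v \<noteq> 0\<^sub>v n" "A *\<^sub>v v = e \<cdot>\<^sub>v v"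
proof -
  let ?B = "map_mat complex_of_real A"
  have B: "?B \<in> carrier_mat n n" using A by simp
  have BT: "?B\<^sup>T = ?B" using sym by (metis map_mat_transpose)
  obtain as where as: "char_poly ?B = (\<Prod>a\<leftarrow>as. [:- a, 1:])" "length as = n"
    using char_poly_factorized[OF B] by auto
  define k where "k = hd as"
  have "poly (char_poly ?B) k = 0"
    using as n unfolding k_def by (cases as) auto
  hence ev: "eigenvalue ?B k" using eigenvalue_root_char_poly[OF B] by simp
  then obtain w where w: "w \<in> carrier_vec n" "w \<noteq> 0\<^sub>v n" "?B *\<^sub>v w = k \<cdot>\<^sub>v w"
    using B unfolding eigenvalue_def eigenvector_def by auto
  have cw: "conjugate w \<in> carrier_vec n" using w by simp
  have conj: "?B *\<^sub>v conjugate w = conjugate (?B *\<^sub>v w)"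
    using A w(1) by (intro eq_vecI) (auto simp: scalar_prod_def)
  have "k * (w \<bullet> conjugate w) = (?B\<^sup>T *\<^sub>v w) \<bullet> conjugate w"
    unfolding BT w(3) using w(1) cw by simp
  also have "\<dots> = w \<bullet> (?B *\<^sub>v conjugate w)"
    by (rule transpose_vec_mult_scalar[OF B cw w(1)])
  also have "\<dots> = cnj k * (w \<bullet> conjugate w)"
    unfolding conj w(3) using w(1) cw by (simp add: conjugate_smult_vec)
  finally have "k = cnj k" using conjugate_square_eq_0_vec[OF w(1)] w(2) by simp
  then obtain e where e: "k = complex_of_real e" by (metis Reals_cnj_iff Reals_cases)
  \<comment> \<open>The vector \<open>w\<close> itself may fail to be real. However,
    \<open>e\<close> is also a root of the real characteristic polynomial, and this supplies a real
    eigenvector.\<close>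
  have "eigenvalue A e"
    using ev unfolding e eigenvalue_root_char_poly[OF A] eigenvalue_root_char_poly[OF B]
    by (simp add: of_real_hom.char_poly_hom[OF A])
  then show thesis using that A unfolding eigenvalue_def eigenvector_def by auto
qed

text \<open>Gram-Schmidt, started from a basis whose first vector is \<open>v\<close>, leaves that
  vector unchanged. Normalizing the result gives the columns of \<open>W\<close>, so
  \<open>c\<close> is the reciprocal of the length of \<open>v\<close>.\<close>

lemma orthogonal_completion:
  fixes v :: "real vec"
  assumes v: "v \<in> carrier_vec n" and v0: "v \<noteq> 0\<^sub>v n"
  obtains W c where "W \<in> carrier_mat n n" "W\<^sup>T * W = 1\<^sub>m n" "W * W\<^sup>T = 1\<^sub>m n"
    "col W 0 = c \<cdot>\<^sub>v v"
proof -
  interpret cof_vec_space n "TYPE(real)" .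
  have n: "n \<noteq> 0" using v v0 by (metis eq_vecI carrier_vecD index_zero_vec(2) less_nat_zero_code)
  define b where "b = basis_completion v"
  define ws where "ws = gram_schmidt n b"
  note bc = basis_completion[OF v v0, folded b_def]
  have b: "set b \<subseteq> carrier_vec n" "distinct b" "\<not> lin_dep (set b)" "hd b = v" "length b = n"
    using bc by auto
  then obtain vs where bv: "b = v # vs" using n by (cases b) auto
  have ws: "set ws \<subseteq> carrier_vec n" "corthogonal ws" "length ws = n"
    using gram_schmidt_result[OF b(1-3) refl, folded ws_def] b(5) by auto
  have hdws: "ws ! 0 = v"
    using gram_schmidt_hd[OF v, of vs, folded bv] ws(3) n
    unfolding ws_def by (metis hd_conv_nth length_0_conv)
  have wsi: "ws ! i \<in> carrier_vec n" if "i < n" for i using ws that by auto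
  \<comment> \<open>Conjugation is trivial over the reals. The case \<open>i = j\<close> says that
    the squared lengths are nonzero, so the later division by \<open>nrm\<close> is sound.\<close>
  have orth: "ws ! i \<bullet> ws ! j = 0 \<longleftrightarrow> i \<noteq> j" if "i < n" "j < n" for i j
    using corthogonalD[OF ws(2), of i j] that ws(3) by simp
  define nrm where "nrm i = sqrt (ws ! i \<bullet> ws ! i)" for i
  have nrm: "nrm i \<noteq> 0" "nrm i * nrm i = ws ! i \<bullet> ws ! i" if "i < n" for i
    using orth[OF that that] conjugate_square_ge_0_vec[of "ws ! i"] unfolding nrm_def by auto
  define W where "W = mat_of_cols n (map (\<lambda>i. (1 / nrm i) \<cdot>\<^sub>v (ws ! i)) [0..<n])"
  have W: "W \<in> carrier_mat n n" unfolding W_def by (rule carrier_matI) simp_all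
  have colW: "col W i = (1 / nrm i) \<cdot>\<^sub>v (ws ! i)" if "i < n" for i
    using that wsi unfolding W_def by (subst col_mat_of_cols) auto
  have WW: "W\<^sup>T * W = 1\<^sub>m n"
  proof (rule eq_matI)
    fix i j assume "i < dim_row (1\<^sub>m n :: real mat)" "j < dim_col (1\<^sub>m n :: real mat)"
    then have ij: "i < n" "j < n" by auto
    then show "(W\<^sup>T * W) $$ (i, j) = 1\<^sub>m n $$ (i, j)"
      using W colW nrm[OF ij(1)] orth[OF ij] smult_scalar_prod_distrib[of _ n _ "1 / nrm i"]
        scalar_prod_smult_distrib[of _ n _ "1 / nrm j"] wsi[OF ij(1)] wsi[OF ij(2)] by auto
  qed (use W in auto)
  moreover have "W * W\<^sup>T = 1\<^sub>m n" using mat_mult_left_right_inverse[OF _ W WW] W by simp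
  ultimately show thesis using that[OF W] colW[of 0] n hdws by auto
qed

lemma mult_inverse_cancel:
  fixes S T X :: "'a :: comm_ring_1 mat"
  assumes "S * T = 1\<^sub>m n" "X \<in> carrier_mat n m" "S \<in> carrier_mat n k" "T \<in> carrier_mat k n"
  shows "S * (T * X) = X"
  using assms by (simp flip: assoc_mult_mat[of S n k T n X m])

text \<open>The inner factor \<open>F^T F = 1\<close> cancels, so sending \<open>M\<close> to
  \<open>F M F^T\<close> is multiplicative. This serves both square orthogonal matrices and
  rectangular ones with orthonormal columns.\<close>

lemma sandwich_mult:
  fixes F :: "real mat"
  assumes F: "F \<in> carrier_mat n d" "F\<^sup>T * F = 1\<^sub>m d"
    and M: "M \<in> carrier_mat d d" and N: "N \<in> carrier_mat d d"
  shows "(F * M * F\<^sup>T) * (F * N * F\<^sup>T) = F * (M * N) * F\<^sup>T"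
proof -
  have FT: "F\<^sup>T \<in> carrier_mat d n" using F by simp
  have FM: "F * M \<in> carrier_mat n d" "F * N \<in> carrier_mat n d" "N * F\<^sup>T \<in> carrier_mat d n"
    using F M N FT by auto
  have "F * N * F\<^sup>T = F * (N * F\<^sup>T)" by (rule assoc_mult_mat[OF F(1) N FT])
  hence "F\<^sup>T * (F * N * F\<^sup>T) = N * F\<^sup>T"
    using mult_inverse_cancel[OF F(2) FM(3) FT F(1)] by simp
  then have "(F * M * F\<^sup>T) * (F * N * F\<^sup>T) = F * M * (N * F\<^sup>T)"
    using assoc_mult_mat[OF FM(1) FT, of "F * N * F\<^sup>T" n] FM FT by simp
  also have "\<dots> = F * (M * N) * F\<^sup>T"
    using assoc_mult_mat[OF FM(1) N FT] assoc_mult_mat[OF F(1) M N] by simp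
  finally show ?thesis .
qed

lemma mat_diag_transpose [simp]: "(mat_diag n f)\<^sup>T = mat_diag n f"
  unfolding mat_diag_def by (intro eq_matI) auto

lemma mat_diag_dims [simp]: "dim_row (mat_diag n f) = n" "dim_col (mat_diag n f) = n"
  unfolding mat_diag_def by auto

text \<open>Deflation: in an orthonormal basis that begins with an eigenvector, \<open>A\<close>
  splits into a 1 by 1 block and a smaller symmetric block, to which the induction hypothesis
  applies.\<close>

lemma symmetric_diagonalization:
  fixes A :: "real mat"
  assumes "A \<in> carrier_mat n n" "A\<^sup>T = A"
  obtains S lam where "S \<in> carrier_mat n n" "S\<^sup>T * S = 1\<^sub>m n" "S * S\<^sup>T = 1\<^sub>m n"
    "A = S * mat_diag n lam * S\<^sup>T"
  using assms
proof (induction n arbitrary: A thesis)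
  case 0
  then show ?case
    by (intro 0(1)[of "0\<^sub>m 0 0" "\<lambda>_. 0"]) (auto intro!: eq_matI)
next
  case (Suc n)
  let ?N = "Suc n"
  note A = Suc.prems(2) and sym = Suc.prems(3)
  obtain e v where v: "v \<in> carrier_vec ?N" "v \<noteq> 0\<^sub>v ?N" "A *\<^sub>v v = e \<cdot>\<^sub>v v"
    using symmetric_eigenvector[OF A sym] by blast
  obtain W c where W: "W \<in> carrier_mat ?N ?N" "W\<^sup>T * W = 1\<^sub>m ?N" "W * W\<^sup>T = 1\<^sub>m ?N"
    and col0: "col W 0 = c \<cdot>\<^sub>v v"
    using orthogonal_completion[OF v(1,2)] by blast
  have WT: "W\<^sup>T \<in> carrier_mat ?N ?N" using W by simp
  define A' where "A' = W\<^sup>T * (A * W)"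
  have A': "A' \<in> carrier_mat ?N ?N" using A W WT unfolding A'_def by simp
  have sym': "A'\<^sup>T = A'"
    unfolding A'_def using A W WT sym
    by (simp add: transpose_mult[of _ ?N ?N _ ?N] assoc_mult_mat[of _ ?N ?N _ ?N _ ?N]
        mult_carrier_mat[of _ ?N ?N _ ?N])
  \<comment> \<open>The first column of \<open>W\<close> is a multiple of the eigenvector, so
    \<open>A\<close> scales it by \<open>e\<close> and \<open>W^T\<close> turns it into the first
    unit vector. By symmetry the first row of \<open>A'\<close> has the same shape, which makes
    \<open>A'\<close> block diagonal.\<close>
  have "col A' 0 = W\<^sup>T *\<^sub>v (A *\<^sub>v col W 0)"
    unfolding A'_def col_mult2[OF WT mult_carrier_mat[OF A W(1)] zero_less_Suc]
      col_mult2[OF A W(1) zero_less_Suc] ..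
  also have "A *\<^sub>v col W 0 = e \<cdot>\<^sub>v col W 0"
    unfolding col0 using A v by (simp add: mult_mat_vec[OF A v(1)] smult_smult_assoc mult.commute)
  also have "W\<^sup>T *\<^sub>v (e \<cdot>\<^sub>v col W 0) = e \<cdot>\<^sub>v col (W\<^sup>T * W) 0"
    unfolding col_mult2[OF WT W(1) zero_less_Suc]
    using W(1) by (intro mult_mat_vec[OF WT]) (simp add: carrier_vecI)
  finally have colA': "col A' 0 = e \<cdot>\<^sub>v unit_vec ?N 0" unfolding W(2) by simp
  have c0: "A' $$ (i, 0) = (if i = 0 then e else 0)" if "i < ?N" for i
    using arg_cong[OF colA', of "\<lambda>x. x $ i"] that A' by (auto simp: unit_vec_def)
  have r0: "A' $$ (0, i) = (if i = 0 then e else 0)" if "i < ?N" for i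
    using arg_cong[OF sym', of "\<lambda>x. x $$ (i, 0)"] that A' c0[OF that] by simp
  define A3 where "A3 = mat n n (\<lambda>(i, j). A' $$ (Suc i, Suc j))"
  have A3: "A3 \<in> carrier_mat n n" unfolding A3_def by simp
  have A3sym: "A3\<^sup>T = A3"
  proof (rule eq_matI)
    fix i j assume "i < dim_row A3" "j < dim_col A3"
    then show "A3\<^sup>T $$ (i, j) = A3 $$ (i, j)"
      using A' arg_cong[OF sym', of "\<lambda>x. x $$ (Suc i, Suc j)"] unfolding A3_def by simp
  qed (use A3 in auto)
  let ?E = "mat 1 1 (\<lambda>_. e)"
  have A'_block: "A' = four_block_mat ?E (0\<^sub>m 1 n) (0\<^sub>m n 1) A3"
  proof (rule eq_matI)
    fix i j assume "i < dim_row (four_block_mat ?E (0\<^sub>m 1 n) (0\<^sub>m n 1) A3)"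
      "j < dim_col (four_block_mat ?E (0\<^sub>m 1 n) (0\<^sub>m n 1) A3)"
    then show "A' $$ (i, j) = four_block_mat ?E (0\<^sub>m 1 n) (0\<^sub>m n 1) A3 $$ (i, j)"
      using c0 r0 A' unfolding A3_def by (cases i; cases j) auto
  qed (use A' A3 in auto)
  obtain S lam where S: "S \<in> carrier_mat n n" "S\<^sup>T * S = 1\<^sub>m n" "S * S\<^sup>T = 1\<^sub>m n"
    and dec: "A3 = S * mat_diag n lam * S\<^sup>T"
    using Suc.IH[OF _ A3 A3sym] by blast
  let ?blk = "\<lambda>X Y. four_block_mat X (0\<^sub>m 1 n) (0\<^sub>m n 1) Y"
  have blk_mult: "?blk X Y * ?blk X' Y' = ?blk (X * X') (Y * Y')"
    if "X \<in> carrier_mat 1 1" "X' \<in> carrier_mat 1 1" "Y \<in> carrier_mat n n" "Y' \<in> carrier_mat n n"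
    for X Y X' Y' :: "real mat"
    using that by (subst mult_four_block_mat[where ?nr1.0=1 and ?nr2.0=n and ?n1.0=1
          and ?n2.0=n and ?nc1.0=1 and ?nc2.0=n]) auto
  have blk_trans: "(?blk X Y)\<^sup>T = ?blk (X\<^sup>T) (Y\<^sup>T)"
    if "X \<in> carrier_mat 1 1" "Y \<in> carrier_mat n n" for X Y :: "real mat"
    using that by (subst transpose_four_block_mat[where ?nr1.0=1 and ?nr2.0=n and ?nc1.0=1 and ?nc2.0=n]) auto
  have blk_one: "?blk (1\<^sub>m 1) (1\<^sub>m n) = (1\<^sub>m ?N :: real mat)"
    by (intro eq_matI) auto
  \<comment> \<open>\<open>case_nat e lam\<close> puts \<open>e\<close> at index 0 and shifts
    \<open>lam\<close> by one.\<close>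
  have blk_diag: "?blk ?E (mat_diag n lam) = mat_diag ?N (case_nat e lam)"
    unfolding mat_diag_def
    by (intro eq_matI) (auto split: nat.splits if_splits simp: less_Suc_eq_0_disj)
  define S1 where "S1 = ?blk (1\<^sub>m 1) S"
  have S1: "S1 \<in> carrier_mat ?N ?N" unfolding S1_def using S(1) by auto
  have S1T: "S1\<^sup>T \<in> carrier_mat ?N ?N" using S1 by simp
  have orth: "S1\<^sup>T * S1 = 1\<^sub>m ?N" "S1 * S1\<^sup>T = 1\<^sub>m ?N"
    unfolding S1_def using S by (simp_all add: blk_trans blk_mult blk_one plus_1_eq_Suc del: One_nat_def)
  have A'_dec: "A' = S1 * mat_diag ?N (case_nat e lam) * S1\<^sup>T"
    unfolding A'_block S1_def dec using S(1)
    by (simp add: blk_trans blk_mult flip: blk_diag del: One_nat_def)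
  let ?D = "mat_diag ?N (case_nat e lam)"
  have D: "?D \<in> carrier_mat ?N ?N" by simp
  have "A = W * A' * W\<^sup>T"
    unfolding A'_def using W WT A
    by (simp add: assoc_mult_mat[of _ ?N ?N _ ?N _ ?N] mult_carrier_mat[of _ ?N ?N _ ?N]
        mult_inverse_cancel[OF W(3), of _ ?N ?N])
  also have "\<dots> = (W * S1) * ?D * (W * S1)\<^sup>T"
    unfolding A'_dec using W(1) WT S1 S1T D
    by (simp add: assoc_mult_mat[of _ ?N ?N _ ?N _ ?N] mult_carrier_mat[of _ ?N ?N _ ?N]
        transpose_mult[of _ ?N ?N _ ?N])
  finally have "A = (W * S1) * ?D * (W * S1)\<^sup>T" .
  moreover have "(W * S1)\<^sup>T * (W * S1) = 1\<^sub>m ?N" "(W * S1) * (W * S1)\<^sup>T = 1\<^sub>m ?N"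
    using W WT S1 S1T orth
    by (simp_all add: assoc_mult_mat[of _ ?N ?N _ ?N _ ?N] mult_carrier_mat[of _ ?N ?N _ ?N]
        transpose_mult[of _ ?N ?N _ ?N]
        mult_inverse_cancel[OF W(2), of _ ?N ?N] mult_inverse_cancel[OF orth(2), of _ ?N ?N])
  ultimately show ?case using Suc.prems(1)[of "W * S1"] W(1) S1 by auto
qed

section \<open>Square roots and Moore-Penrose inverses\<close>

lemma quadratic_form_gram:
  fixes B :: "real mat"
  assumes B: "B \<in> carrier_mat k n" and x: "x \<in> carrier_vec n"
  shows "x \<bullet> ((B\<^sup>T * B) *\<^sub>v x) = (B *\<^sub>v x) \<bullet> (B *\<^sub>v x)"
proof -
  have Bx: "B *\<^sub>v x \<in> carrier_vec k" using B x by simp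
  have "x \<bullet> ((B\<^sup>T * B) *\<^sub>v x) = x \<bullet> (B\<^sup>T *\<^sub>v (B *\<^sub>v x))"
    using B x by (simp add: assoc_mult_mat_vec[of _ n k _ n])
  also have "\<dots> = (B\<^sup>T *\<^sub>v (B *\<^sub>v x)) \<bullet> x"
    using B x Bx by (intro comm_scalar_prod[of _ n]) auto
  also have "\<dots> = (B *\<^sub>v x) \<bullet> (B *\<^sub>v x)"
    by (rule transpose_vec_mult_scalar[OF B x Bx])
  finally show ?thesis .
qed

lemma scalar_prod_self_nonneg: "0 \<le> x \<bullet> (x :: real vec)"
  unfolding scalar_prod_def by (intro sum_nonneg) auto

lemma scalar_prod_self_eq_0:
  assumes "x \<bullet> (x :: real vec) = 0"
  shows "x = 0\<^sub>v (dim_vec x)"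
  using conjugate_square_eq_0_vec[of x "dim_vec x"] assms by auto

lemma nonneg_definite_gram:
  assumes B: "B \<in> carrier_mat k n"
  shows "nonneg_definite n (B\<^sup>T * B)"
  unfolding nonneg_definite_def
  using B quadratic_form_gram[OF B] scalar_prod_self_nonneg
  by (auto simp: transpose_mult[of _ n k _ n])

text \<open>The quadratic form takes the value \<open>lam i\<close> at the \<open>i\<close>-th
  column of \<open>S\<close>. Conversely, nonnegative entries have square roots, which exhibit
  \<open>W\<close> as a Gram matrix.\<close>

lemma nonneg_definite_diagonalized:
  assumes S: "S \<in> carrier_mat n n" "S\<^sup>T * S = 1\<^sub>m n"
    and W: "W = S * mat_diag n lam * S\<^sup>T"
  shows "nonneg_definite n W \<longleftrightarrow> (\<forall>i<n. 0 \<le> lam i)"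
proof
  assume nn: "nonneg_definite n W"
  show "\<forall>i<n. 0 \<le> lam i"
  proof (intro allI impI)
    fix i assume i: "i < n"
    have ST: "S\<^sup>T \<in> carrier_mat n n" using S by simp
    have D: "mat_diag n lam \<in> carrier_mat n n" by simp
    define x where "x = col S i"
    have x: "x \<in> carrier_vec n" unfolding x_def using S i by auto
    have "S\<^sup>T *\<^sub>v x = col (S\<^sup>T * S) i" 
      unfolding x_def using S(1) ST i by (subst col_mult2[of _ n n _ n]) auto
    hence STx: "S\<^sup>T *\<^sub>v x = unit_vec n i" unfolding S(2) using i by simp
    have "W *\<^sub>v x = S *\<^sub>v (mat_diag n lam *\<^sub>v unit_vec n i)"
      unfolding W using S(1) ST D x
      by (simp add: assoc_mult_mat_vec[of _ n n _ n] STx[symmetric] mult_carrier_mat[of _ n n _ n])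
    also have "mat_diag n lam *\<^sub>v unit_vec n i = lam i \<cdot>\<^sub>v unit_vec n i"
      using i by (intro eq_vecI) (auto simp: mat_diag_def)
    finally have Wx: "W *\<^sub>v x = S *\<^sub>v (lam i \<cdot>\<^sub>v unit_vec n i)" .
    have "x \<bullet> (W *\<^sub>v x) = (S\<^sup>T *\<^sub>v x) \<bullet> (lam i \<cdot>\<^sub>v unit_vec n i)"
      unfolding Wx using S(1) x by (subst transpose_vec_mult_scalar[of S n n]) auto
    also have "\<dots> = lam i" unfolding STx using i by simp
    finally show "0 \<le> lam i" using nn x unfolding nonneg_definite_def by metis
  qed
next
  assume nn: "\<forall>i<n. 0 \<le> lam i"
  let ?D = "mat_diag n (\<lambda>i. sqrt (lam i))"
  have D: "?D \<in> carrier_mat n n" by simp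
  have "mat_diag n lam = ?D * ?D"
    using nn by (subst mat_diag_diag) (intro eq_matI, auto simp: mat_diag_def)
  hence "W = (?D * S\<^sup>T)\<^sup>T * (?D * S\<^sup>T)"
    unfolding W using S(1) D
    by (simp add: transpose_mult[of _ n n _ n] assoc_mult_mat[of _ n n _ n _ n] mult_carrier_mat[of _ n n _ n] del: mat_diag_diag)
  then show "nonneg_definite n W"
    using nonneg_definite_gram[of "?D * S\<^sup>T" n n] S(1) D by auto
qed

lemma nonneg_definite_diagonalization:
  assumes "nonneg_definite n A"
  obtains S lam where "S \<in> carrier_mat n n" "S\<^sup>T * S = 1\<^sub>m n" "S * S\<^sup>T = 1\<^sub>m n"
    "A = S * mat_diag n lam * S\<^sup>T" "\<And>i. i < n \<Longrightarrow> 0 \<le> lam i"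
proof -
  have "A \<in> carrier_mat n n" "A\<^sup>T = A" using assms unfolding nonneg_definite_def by auto
  then obtain S lam where "S \<in> carrier_mat n n" "S\<^sup>T * S = 1\<^sub>m n" "S * S\<^sup>T = 1\<^sub>m n"
    "A = S * mat_diag n lam * S\<^sup>T" using symmetric_diagonalization by blast
  with assms nonneg_definite_diagonalized[of S n A lam] that show thesis by blast
qed

text \<open>For \<open>R = U D U\<^sup>T\<close> and \<open>R' = V D' V\<^sup>T\<close> the matrix \<open>M = V\<^sup>T U\<close> intertwines \<open>D\<^sup>2\<close> and \<open>D'\<^sup>2\<close>. Comparing
  entries, it intertwines \<open>D\<close> and \<open>D'\<close>, because their entries are nonnegative.\<close>

lemma nonneg_sqrt_unique:
  assumes R: "nonneg_definite n R" and R': "nonneg_definite n R'" and eq: "R * R = R' * R'"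
  shows "R = R'"
proof -
  obtain U a where U: "U \<in> carrier_mat n n" "U\<^sup>T * U = 1\<^sub>m n" "U * U\<^sup>T = 1\<^sub>m n"
    "R = U * mat_diag n a * U\<^sup>T" and a: "\<And>i. i < n \<Longrightarrow> 0 \<le> a i"
    using nonneg_definite_diagonalization[OF R] by blast
  obtain V b where V: "V \<in> carrier_mat n n" "V\<^sup>T * V = 1\<^sub>m n" "V * V\<^sup>T = 1\<^sub>m n"
    "R' = V * mat_diag n b * V\<^sup>T" and b: "\<And>i. i < n \<Longrightarrow> 0 \<le> b i"
    using nonneg_definite_diagonalization[OF R'] by blast
  have T: "U\<^sup>T \<in> carrier_mat n n" "V\<^sup>T \<in> carrier_mat n n" using U V by auto
  have D: "mat_diag n f \<in> carrier_mat n n" for f :: "nat \<Rightarrow> real" by simp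
  note assoc = assoc_mult_mat[of _ n n _ n _ n] mult_carrier_mat[of _ n n _ n]
  define M where "M = V\<^sup>T * U"
  have M: "M \<in> carrier_mat n n" unfolding M_def using U(1) T by simp
  have "M * mat_diag n (\<lambda>i. a i * a i) = V\<^sup>T * (R * R) * U"
    unfolding U(4) sandwich_mult[OF U(1,2) D D] mat_diag_diag M_def
    using U(1,2) T D by (simp add: assoc right_mult_one_mat[of _ n n])
  also have "\<dots> = mat_diag n (\<lambda>i. b i * b i) * M"
    unfolding eq V(4) sandwich_mult[OF V(1,2) D D] mat_diag_diag M_def
    using U(1) V(1) T D by (simp add: assoc mult_inverse_cancel[OF V(2), of _ n n])
  finally have sq: "M * mat_diag n (\<lambda>i. a i * a i) = mat_diag n (\<lambda>i. b i * b i) * M" .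
  have "M * mat_diag n a = mat_diag n b * M"
  proof (rule eq_matI)
    fix i j assume "i < dim_row (mat_diag n b * M)" "j < dim_col (mat_diag n b * M)"
    then have ij: "i < n" "j < n" using M D by auto
    have "M $$ (i, j) * (a j * a j) = (b i * b i) * M $$ (i, j)"
      using arg_cong[OF sq, of "\<lambda>X. X $$ (i, j)"] ij
      by (simp add: mat_diag_mult_left[OF M] mat_diag_mult_right[OF M])
    hence "M $$ (i, j) = 0 \<or> a j * a j = b i * b i" by auto
    hence "M $$ (i, j) = 0 \<or> a j = b i" using a[OF ij(2)] b[OF ij(1)]
      by (metis abs_of_nonneg real_sqrt_mult_self real_sqrt_abs2)
    then show "(M * mat_diag n a) $$ (i, j) = (mat_diag n b * M) $$ (i, j)"
      using ij by (auto simp add: mat_diag_mult_left[OF M] mat_diag_mult_right[OF M])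
  qed (use M D in auto)
  \<comment> \<open>Multiplying by \<open>V\<close> and \<open>U^T\<close> undoes \<open>M\<close>:
    \<open>V M = U\<close> turns the left side into \<open>R\<close>, and \<open>M U^T = V^T\<close>
    turns the right side into \<open>R'\<close>.\<close>
  hence "V * (M * mat_diag n a) * U\<^sup>T = V * (mat_diag n b * M) * U\<^sup>T" by simp
  then show ?thesis
    unfolding M_def U(4) V(4) using U V T D
    by (simp add: assoc mult_inverse_cancel[OF V(3), of _ n n])
qed

text \<open>Uniqueness of the root allows the definite description to be evaluated at any
  candidate.\<close>

lemma mat_sqrt_eqI:
  assumes "nonneg_definite n R" "R * R = A"
  shows "mat_sqrt A = R"
proof -
  have "dim_row A = n" using assms unfolding nonneg_definite_def by auto
  then show ?thesis unfolding mat_sqrt_def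
    using assms nonneg_sqrt_unique by (intro the_equality) auto
qed

lemma mat_sqrt_diagonalized:
  assumes S: "S \<in> carrier_mat n n" "S\<^sup>T * S = 1\<^sub>m n" and lam: "\<And>i. i < n \<Longrightarrow> 0 \<le> lam i"
  shows "mat_sqrt (S * mat_diag n lam * S\<^sup>T) = S * mat_diag n (\<lambda>i. sqrt (lam i)) * S\<^sup>T"
proof (rule mat_sqrt_eqI)
  show "nonneg_definite n (S * mat_diag n (\<lambda>i. sqrt (lam i)) * S\<^sup>T)"
    using nonneg_definite_diagonalized[OF S refl] lam by simp
  have "mat_diag n (\<lambda>i. sqrt (lam i) * sqrt (lam i)) = mat_diag n lam"
    using lam unfolding mat_diag_def by (intro eq_matI) auto
  then show "(S * mat_diag n (\<lambda>i. sqrt (lam i)) * S\<^sup>T) * (S * mat_diag n (\<lambda>i. sqrt (lam i)) * S\<^sup>T)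
      = S * mat_diag n lam * S\<^sup>T"
    using sandwich_mult[OF S mat_diag_dim mat_diag_dim] by simp
qed

text \<open>For a second inverse \<open>B'\<close>, inserting \<open>A = A B A\<close> and
  transposing products of symmetric factors gives \<open>A B' = A B\<close> and
  \<open>B' A = B A\<close>. Then \<open>B' = B' A B' = B' A B = B A B = B\<close>.\<close>

lemma mp_inverse_eqI:
  assumes B: "is_mp_inverse A B"
  shows "mp_inverse A = B"
proof -
  have "B' = B" if B': "is_mp_inverse A B'" for B'
  proof -
    define r c where "r = dim_row A" and "c = dim_col A"
    have A: "A \<in> carrier_mat r c" unfolding r_def c_def by simp
    have c: "B \<in> carrier_mat c r" "B' \<in> carrier_mat c r"
      and P: "A * B * A = A" "B * A * B = B" "(A * B)\<^sup>T = A * B" "(B * A)\<^sup>T = B * A"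
      and P': "A * B' * A = A" "B' * A * B' = B'" "(A * B')\<^sup>T = A * B'" "(B' * A)\<^sup>T = B' * A"
      using B B' unfolding is_mp_inverse_def r_def c_def by auto
    have AB: "A * B \<in> carrier_mat r r" "A * B' \<in> carrier_mat r r" 
      "B * A \<in> carrier_mat c c" "B' * A \<in> carrier_mat c c" using A c by auto
    have "A * B' = A * B * A * B'" unfolding P ..
    also have "\<dots> = (A * B) * (A * B')" using A c AB assoc_mult_mat[of "A * B" r r A c B' r] by simp
    also have "\<dots> = ((A * B')* (A * B))\<^sup>T"
      using P(3) P'(3) transpose_mult[OF AB(2) AB(1)] by simp
    also have "(A * B')* (A * B) = A * B' * A * B" using A c AB assoc_mult_mat[of "A * B'" r r A c B r] by simp
    finally have 1: "A * B' = A * B" unfolding P' P .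
    have "B' * A = B' * (A * B * A)" unfolding P ..
    also have "\<dots> = (B' * A) * (B * A)" using A c AB assoc_mult_mat[of A r c B r A c]
       assoc_mult_mat[of B' c r A c "B * A" c] by simp
    also have "\<dots> = ((B * A)* (B' * A))\<^sup>T"
      using P(4) P'(4) transpose_mult[OF AB(3) AB(4)] by simp
    also have "(B * A)* (B' * A) = B * (A * B' * A)" using A c AB assoc_mult_mat[of A r c B' r A c]
       assoc_mult_mat[of B c r A c "B' * A" c] by simp
    finally have 2: "B' * A = B * A" unfolding P' P .
    have "B' = B' * (A * B')" using P'(2) assoc_mult_mat[OF c(2) A c(2)] by simp
    also have "\<dots> = B' * A * B" unfolding 1 using assoc_mult_mat[OF c(2) A c(1)] by simp
    finally show ?thesis unfolding 2 P .
  qed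
  with B show ?thesis unfolding mp_inverse_def by blast
qed

section \<open>Column spaces and ranks\<close>

text \<open>Turns inclusions of column spaces into matrix factorizations, the form in which they
  enter all later computations. The columns of \<open>Z\<close> are preimages under \<open>B\<close>
  of the columns of \<open>A\<close>.\<close>

lemma column_space_subset_iff:
  assumes A: "A \<in> carrier_mat n a" and B: "B \<in> carrier_mat n b"
  shows "column_space A \<subseteq> column_space B \<longleftrightarrow> (\<exists>Z \<in> carrier_mat b a. A = B * Z)"
proof -
  have cA: "column_space A = {A *\<^sub>v x | x. x \<in> carrier_vec a}"
    using A vec_space.col_space_eq[OF A] by auto
  have cB: "column_space B = {B *\<^sub>v x | x. x \<in> carrier_vec b}"
    using B vec_space.col_space_eq[OF B] by auto
  show ?thesis
  proof
    assume sub: "column_space A \<subseteq> column_space B"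
    have "\<exists>z \<in> carrier_vec b. col A j = B *\<^sub>v z" if j: "j < a" for j
    proof -
      have "col A j = A *\<^sub>v unit_vec a j" using A j by (intro eq_vecI) auto
      hence "col A j \<in> column_space A" unfolding cA by auto
      with sub show ?thesis unfolding cB by auto
    qed
    then obtain z where z: "\<And>j. j < a \<Longrightarrow> z j \<in> carrier_vec b \<and> col A j = B *\<^sub>v z j" by metis
    define Z where "Z = mat_of_cols b (map z [0..<a])"
    have Z: "Z \<in> carrier_mat b a" unfolding Z_def by (rule carrier_matI) simp_all
    have "A = B * Z"
    proof (rule mat_col_eqI)
      fix j assume "j < dim_col (B * Z)"
      hence j: "j < a" using Z by simp
      have "col Z j = z j" unfolding Z_def using j z by (subst col_mat_of_cols) auto
      then show "col A j = col (B * Z) j" using z[OF j] col_mult2[OF B Z j] by simp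
    qed (use A B Z in auto)
    with Z show "\<exists>Z \<in> carrier_mat b a. A = B * Z" by blast
  next
    assume "\<exists>Z \<in> carrier_mat b a. A = B * Z"
    then obtain Z where Z: "Z \<in> carrier_mat b a" "A = B * Z" by blast
    then show "column_space A \<subseteq> column_space B"
      unfolding cA cB using B by (auto simp: assoc_mult_mat_vec[of _ n b _ a])
  qed
qed

lemma mat_rank_cong:
  assumes "A \<in> carrier_mat n a" "B \<in> carrier_mat n b" "column_space A = column_space B"
  shows "mat_rank A = mat_rank B"
  using assms unfolding mat_rank_def vec_space.rank_def vec_space.col_space_def by simp

text \<open>\<open>F^T\<close> is a left inverse of \<open>F\<close>, so no nontrivial combination
  of the columns vanishes.\<close>

lemma mat_rank_orthonormal_cols:
  assumes F: "F \<in> carrier_mat n d" and FF: "F\<^sup>T * F = 1\<^sub>m d"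
  shows "mat_rank F = d"
proof -
  interpret vec_space "TYPE(real)" n .
  have FT: "F\<^sup>T \<in> carrier_mat d n" using F by simp
  have inner: "col F i \<bullet> col F j = (if i = j then 1 else 0)" if "i < d" "j < d" for i j
    using arg_cong[OF FF, of "\<lambda>X. X $$ (i, j)"] that F by simp
  \<comment> \<open>Linear independence is stated for the set of columns, in which a repeated column
    would go unnoticed.\<close>
  have dist: "distinct (cols F)"
    unfolding distinct_conv_nth
  proof (intro allI impI)
    fix i j assume ij: "i < length (cols F)" "j < length (cols F)" "i \<noteq> j"
    then show "cols F ! i \<noteq> cols F ! j"
      using F inner[of i j] inner[of j j] by auto
  qed
  have "lin_indpt (set (cols F))"
  proof
    assume "lin_dep (set (cols F))"
    then obtain x where x: "x \<in> carrier_vec d" "x \<noteq> 0\<^sub>v d" "F *\<^sub>v x = 0\<^sub>v n"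
      using lin_depE[OF F _ dist] by blast
    have "x = (F\<^sup>T * F) *\<^sub>v x" using x(1) unfolding FF by simp
    also have "\<dots> = 0\<^sub>v d" using x F FT by (auto simp: assoc_mult_mat_vec[of _ d n _ d])
    finally show False using x(2) by simp
  qed
  then show ?thesis
    using lin_indpt_full_rank[OF F dist] F unfolding mat_rank_def by simp
qed

section \<open>Leading columns of an orthogonal matrix and zero padding\<close>

abbreviation zero_padded :: "nat \<Rightarrow> nat \<Rightarrow> 'a::zero mat \<Rightarrow> 'a mat" where
  "zero_padded n d M \<equiv>
     four_block_mat M (0\<^sub>m d (n - d)) (0\<^sub>m (n - d) d) (0\<^sub>m (n - d) (n - d))"

lemma leading_cols:
  assumes "S \<in> carrier_mat n n" "d \<le> n"
  shows "mat_of_cols n (take d (cols S)) = mat n d (\<lambda>(i, j). S $$ (i, j))"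
  using assms by (intro eq_matI) (auto simp: mat_of_cols_def)

lemma leading_cols_orthonormal:
  fixes S :: "real mat"
  assumes S: "S \<in> carrier_mat n n" "S\<^sup>T * S = 1\<^sub>m n" and d: "d \<le> n"
  defines "F \<equiv> mat_of_cols n (take d (cols S))"
  shows "F\<^sup>T * F = 1\<^sub>m d"
proof (rule eq_matI)
  fix i j assume "i < dim_row (1\<^sub>m d :: real mat)" "j < dim_col (1\<^sub>m d :: real mat)"
  then have ij: "i < d" "j < d" by auto
  have c: "col F k = col S k" if "k < d" for k
    unfolding F_def leading_cols[OF S(1) d] using that S(1) d by (intro eq_vecI) auto
  have "(F\<^sup>T * F) $$ (i, j) = (S\<^sup>T * S) $$ (i, j)"
    using ij S(1) d c by (simp add: F_def leading_cols[OF S(1) d])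
  then show "(F\<^sup>T * F) $$ (i, j) = 1\<^sub>m d $$ (i, j)" unfolding S(2) using ij d by simp
qed (use d S in \<open>auto simp: F_def leading_cols\<close>)

text \<open>\<open>F = S J\<close>, where \<open>J\<close> holds the first \<open>d\<close> columns
  of the identity, and \<open>J M J^T\<close> is \<open>M\<close> padded with zeros. For orthogonal
  \<open>S\<close> this rewrites a product with a rectangular \<open>F\<close> as a similarity of
  square matrices.\<close>

lemma leading_cols_sandwich:
  fixes S :: "real mat"
  assumes S: "S \<in> carrier_mat n n" and d: "d \<le> n" and M: "M \<in> carrier_mat d d"
  defines "F \<equiv> mat_of_cols n (take d (cols S))"
  shows "F * M * F\<^sup>T = S * zero_padded n d M * S\<^sup>T"
proof -
  define J :: "real mat" where "J = mat n d (\<lambda>(i, j). if i = j then 1 else 0)"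
  have J: "J \<in> carrier_mat n d" unfolding J_def by simp
  have F: "F = S * J"
    unfolding F_def leading_cols[OF S d] J_def using S d
    by (intro eq_matI) (auto simp: scalar_prod_def if_distrib[of "\<lambda>x. x * y" for y]
        if_distrib[of "\<lambda>x. y * x" for y] cong: if_cong)
  have "J * M = mat n d (\<lambda>(i, j). if i < d then M $$ (i, j) else 0)"
    unfolding J_def using M d
    by (intro eq_matI) (auto simp: scalar_prod_def if_distrib[of "\<lambda>x. x * y" for y]
        if_distrib[of "\<lambda>x. y * x" for y] cong: if_cong)
  hence pad: "J * M * J\<^sup>T = zero_padded n d M"
    unfolding J_def using M d
    by (intro eq_matI) (auto simp: scalar_prod_def if_distrib[of "\<lambda>x. x * y" for y]
        if_distrib[of "\<lambda>x. y * x" for y] cong: if_cong)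
  have "F * M * F\<^sup>T = S * (J * M * J\<^sup>T) * S\<^sup>T"
    unfolding F using S J M
    by (simp add: transpose_mult[of _ n n _ d] assoc_mult_mat[of _ n n _ d _ d]
        assoc_mult_mat[of _ n n _ d _ n] assoc_mult_mat[of _ n d _ d _ n]
        assoc_mult_mat[of _ n d _ n _ n] assoc_mult_mat[of _ n n _ n _ n]
        assoc_mult_mat[of _ d d _ n _ n] mult_carrier_mat[of _ d d _ n]
        mult_carrier_mat[of _ d n _ n] mult_carrier_mat[of _ n d _ n])
  then show ?thesis unfolding pad .
qed

lemma diagonalized_leading_cols:
  fixes S :: "real mat"
  assumes S: "S \<in> carrier_mat n n" and d: "d \<le> n"
    and zero: "\<And>i. d \<le> i \<Longrightarrow> i < n \<Longrightarrow> lam i = 0"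
  defines "F \<equiv> mat_of_cols n (take d (cols S))"
  shows "S * mat_diag n lam * S\<^sup>T = F * mat_diag d lam * F\<^sup>T"
proof -
  have "mat_diag n lam = zero_padded n d (mat_diag d lam)"
    unfolding mat_diag_def using d zero by (intro eq_matI) auto
  then show ?thesis
    using leading_cols_sandwich[OF S d, of "mat_diag d lam"] unfolding F_def by simp
qed

section \<open>Eigenvalues\<close>

text \<open>Expresses the complex spectrum through the real characteristic polynomial, so that
  similarity over the reals suffices to compare spectra.\<close>

lemma eigenvalue_mset_eq:
  assumes "A \<in> carrier_mat n n"
  shows "eigenvalue_mset A = proots (map_poly complex_of_real (char_poly A))"
  unfolding eigenvalue_mset_def of_real_hom.char_poly_hom[OF assms] ..

text \<open>The characteristic polynomial of a block diagonal matrix is the product over its blocks,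
  and the zero block contributes a power of the indeterminate.\<close>

lemma eigenvalue_mset_zero_padded:
  assumes d: "d \<le> n" and M: "M \<in> carrier_mat d d"
  shows "eigenvalue_mset (zero_padded n d M) = eigenvalue_mset M + replicate_mset (n - d) 0"
proof -
  let ?c = "map_mat complex_of_real"
  let ?k = "n - d"
  let ?Z = "0\<^sub>m ?k ?k :: complex mat"
  have cM: "?c M \<in> carrier_mat d d" using M by simp
  have blk: "?c (zero_padded n d M) = zero_padded n d (?c M)"
    using M by (subst map_four_block_mat[of _ d d _ ?k _ ?k]) auto
  \<comment> \<open>The product rule for blocks is applied with both factors split into linear ones,
    which is always possible over the complex numbers.\<close>
  have lin: "\<exists>es. char_poly X = (\<Prod>a\<leftarrow>es. [:- a, 1:])" if "X \<in> carrier_mat k k"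
    for X :: "complex mat" and k using char_poly_factorized[OF that] by blast
  have "char_poly ?Z = (\<Prod>a\<leftarrow>diag_mat ?Z. [:- a, 1:])"
    by (rule char_poly_upper_triangular[of _ ?k]) auto
  also have "diag_mat ?Z = replicate ?k 0"
    unfolding diag_mat_def by (intro nth_equalityI) auto
  finally have cZ: "char_poly ?Z = [:0, 1:] ^ ?k" by simp
  have "char_poly (zero_padded n d (?c M)) = char_poly (?c M) * char_poly ?Z"
    by (rule char_poly_0_block[OF refl lin[OF cM] lin cM]) auto
  moreover have "char_poly (?c M) \<noteq> 0" using degree_monic_char_poly[OF cM] by auto
  ultimately show ?thesis
    unfolding eigenvalue_mset_def blk cZ
    by (simp add: proots_mult proots_power repeat_mset_replicate_mset)
qed

text \<open>Invertibility gives a nonzero determinant, hence 0 is not an eigenvalue. In the final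
  comparison of spectra this separates genuine eigenvalues from the zeros due to padding.\<close>

lemma zero_notin_eigenvalue_mset:
  assumes A: "A \<in> carrier_mat n n" and inv: "A * B = 1\<^sub>m n" and B: "B \<in> carrier_mat n n"
  shows "0 \<notin># eigenvalue_mset A"
proof -
  have "det A * det B = 1" using det_mult[OF A B] inv by simp
  moreover have "char_matrix (map_mat complex_of_real A) 0 = map_mat complex_of_real A"
    using A unfolding char_matrix_def by (intro eq_matI) auto
  ultimately have "\<not> eigenvalue (map_mat complex_of_real A) 0"
    using A eigenvalue_det[of "map_mat complex_of_real A" n 0] by auto
  hence "poly (char_poly (map_mat complex_of_real A)) 0 \<noteq> 0"
    using eigenvalue_root_char_poly[of "map_mat complex_of_real A" n 0] A by simp
  then show ?thesis unfolding eigenvalue_mset_def by (cases "char_poly (map_mat complex_of_real A) = 0") auto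
qed

section \<open>Information matrices\<close>

lemma gram_eq_zero:
  fixes B :: "real mat"
  assumes B: "B \<in> carrier_mat k n" and zero: "B\<^sup>T * B = 0\<^sub>m n n"
  shows "B = 0\<^sub>m k n"
proof (rule eq_matI)
  fix i j assume "i < dim_row (0\<^sub>m k n :: real mat)" "j < dim_col (0\<^sub>m k n :: real mat)"
  then have ij: "i < k" "j < n" by auto
  have "col B j \<bullet> col B j = 0"
    using arg_cong[OF zero, of "\<lambda>X. X $$ (j, j)"] ij B by simp
  hence "col B j = 0\<^sub>v k" using scalar_prod_self_eq_0[of "col B j"] B by simp
  then show "B $$ (i, j) = 0\<^sub>m k n $$ (i, j)"
    using ij B by (metis carrier_matD index_col index_zero_mat(1) index_zero_vec(1))
qed (use B in auto)

text \<open>With \<open>Y = G L\<^sup>T L - I\<close> one has \<open>(L Y)\<^sup>T (L Y) = Y\<^sup>T (L\<^sup>T L Y) = 0\<close>.\<close>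

lemma generalized_inverse_gram:
  assumes L: "L \<in> carrier_mat n m" and G: "is_generalized_inverse (L\<^sup>T * L) G"
  shows "L * (G * (L\<^sup>T * L)) = L"
proof -
  let ?A = "L\<^sup>T * L"
  have A: "?A \<in> carrier_mat m m" and Gc: "G \<in> carrier_mat m m" and LT: "L\<^sup>T \<in> carrier_mat m n"
    using L G unfolding is_generalized_inverse_def by auto
  have AGA: "?A * (G * ?A) = ?A"
    using G assoc_mult_mat[OF A Gc A] unfolding is_generalized_inverse_def by simp
  define Y where "Y = G * ?A - 1\<^sub>m m"
  have Y: "Y \<in> carrier_mat m m" unfolding Y_def using A Gc by auto
  have YT: "Y\<^sup>T \<in> carrier_mat m m" using Y by simp
  have LY: "L * Y \<in> carrier_mat n m" using L Y by simp
  have "?A * Y = ?A * (G * ?A) - ?A * 1\<^sub>m m"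
    unfolding Y_def using A Gc by (intro mult_minus_distrib_mat[of _ m m _ m]) auto
  also have "\<dots> = 0\<^sub>m m m" unfolding AGA right_mult_one_mat[OF A] using A by (intro eq_matI) auto
  finally have AY: "?A * Y = 0\<^sub>m m m" .
  have "(L * Y)\<^sup>T * (L * Y) = Y\<^sup>T * (L\<^sup>T * (L * Y))"
    using transpose_mult[OF L Y] assoc_mult_mat[OF YT LT LY] by simp
  also have "L\<^sup>T * (L * Y) = 0\<^sub>m m m" using assoc_mult_mat[OF LT L Y] AY by simp
  also have "Y\<^sup>T * 0\<^sub>m m m = 0\<^sub>m m m" using YT by simp
  finally have LY0: "L * Y = 0\<^sub>m n m" by (rule gram_eq_zero[OF LY])
  have "L * Y = L * (G * ?A) - L * 1\<^sub>m m"
    unfolding Y_def using A Gc L by (intro mult_minus_distrib_mat[of _ n m _ m]) auto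
  hence *: "L * (G * ?A) - L = 0\<^sub>m n m" using LY0 L by simp
  show ?thesis
  proof (rule eq_matI)
    fix i j assume ij: "i < dim_row L" "j < dim_col L"
    have "(L * (G * ?A) - L) $$ (i, j) = 0" unfolding * using ij L by simp
    then show "(L * (G * ?A)) $$ (i, j) = L $$ (i, j)" using ij by simp
  qed (use L A Gc in auto)
qed

text \<open>The generalized inverse \<open>G\<close> may be asymmetric, so symmetry is obtained
  indirectly: \<open>P L = L\<close> yields \<open>P P^T = P^T\<close>, whose left side is
  symmetric. Hence \<open>P^T = P\<close>, and the same equation becomes idempotence.\<close>

lemma projector_symmetric_idempotent:
  assumes L: "L \<in> carrier_mat n m" and G: "is_generalized_inverse (L\<^sup>T * L) G"
  shows "projector L G \<in> carrier_mat n n" "(projector L G)\<^sup>T = projector L G"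
    "projector L G * projector L G = projector L G"
proof -
  let ?A = "L\<^sup>T * L" and ?P = "projector L G"
  have A: "?A \<in> carrier_mat m m" and Gc: "G \<in> carrier_mat m m" and LT: "L\<^sup>T \<in> carrier_mat m n"
    and GT: "G\<^sup>T \<in> carrier_mat m m"
    using L G unfolding is_generalized_inverse_def by auto
  show P: "?P \<in> carrier_mat n n" unfolding projector_def using L Gc by auto
  hence PT: "?P\<^sup>T \<in> carrier_mat n n" by simp
  have Q: "G\<^sup>T * L\<^sup>T \<in> carrier_mat m n" using GT LT by simp
  have PT_eq: "?P\<^sup>T = L * (G\<^sup>T * L\<^sup>T)"
    unfolding projector_def using L LT Gc GT transpose_mult[of "L * G" n m "L\<^sup>T" n] transpose_mult[OF L Gc] by simp
  have GL: "G * L\<^sup>T \<in> carrier_mat m n" using Gc LT by simp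
  have "?P * L = L * (G * ?A)"
    unfolding projector_def using L LT Gc GL
    by (simp add: assoc_mult_mat[OF L Gc LT] assoc_mult_mat[OF L GL L] assoc_mult_mat[OF Gc LT L])
  hence PL: "?P * L = L" using generalized_inverse_gram[OF L G] by simp
  have PPT: "?P * ?P\<^sup>T = ?P\<^sup>T" unfolding PT_eq using assoc_mult_mat[OF P L Q] PL by simp
  have "(?P * ?P\<^sup>T)\<^sup>T = ?P * ?P\<^sup>T" using transpose_mult[OF P PT] by simp
  then show sym: "?P\<^sup>T = ?P" unfolding PPT by simp
  show "?P * ?P = ?P" using PPT unfolding sym .
qed

text \<open>\<open>Q = I - P\<close> is again symmetric and idempotent, so \<open>X^T Q X\<close> is
  the Gram matrix of \<open>B = Q X\<close>.\<close>

lemma info_matrix_gram: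
  assumes X: "X \<in> carrier_mat n v" and L: "L \<in> carrier_mat n m"
    and G: "is_generalized_inverse (L\<^sup>T * L) G"
  obtains B where "B \<in> carrier_mat n v" "info_matrix L G X = B\<^sup>T * B"
proof -
  let ?P = "projector L G"
  define Q where "Q = 1\<^sub>m n - ?P"
  note P = projector_symmetric_idempotent[OF L G]
  have Q: "Q \<in> carrier_mat n n" unfolding Q_def using P(1) by (auto intro: minus_carrier_mat)
  have QT: "Q\<^sup>T = Q" unfolding Q_def using P transpose_minus[of "1\<^sub>m n" n n ?P] by simp
  have "Q * Q = Q * 1\<^sub>m n - Q * ?P"
    using mult_minus_distrib_mat[OF Q one_carrier_mat P(1)] unfolding Q_def[symmetric] by simp
  also have "Q * ?P = ?P - ?P * ?P"
    using minus_mult_distrib_mat[OF one_carrier_mat P(1) P(1)] P(1) unfolding Q_def by simp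
  also have "\<dots> = 0\<^sub>m n n" unfolding P(3) using P(1) by simp
  also have "Q * 1\<^sub>m n - 0\<^sub>m n n = Q" using Q by auto
  finally have QQ: "Q * Q = Q" .
  have XT: "X\<^sup>T \<in> carrier_mat v n" using X by simp
  have QX: "Q * X \<in> carrier_mat n v" using Q X by simp
  have "(Q * X)\<^sup>T * (Q * X) = X\<^sup>T * Q * (Q * X)"
    using transpose_mult[OF Q X] QT by simp
  also have "\<dots> = X\<^sup>T * (Q * (Q * X))" using assoc_mult_mat[OF XT Q QX] .
  also have "Q * (Q * X) = Q * X" using assoc_mult_mat[OF Q Q X] QQ by simp
  also have "X\<^sup>T * (Q * X) = info_matrix L G X"
    unfolding info_matrix_def using L assoc_mult_mat[OF XT Q X] by (simp add: Q_def)
  finally show thesis using that[OF QX] by simp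
qed

section \<open>Moore-Penrose inverse and rank of products with orthonormal columns\<close>

lemma sandwich_transpose:
  fixes F :: "real mat"
  assumes F: "F \<in> carrier_mat n d" and M: "M \<in> carrier_mat d d"
  shows "(F * M * F\<^sup>T)\<^sup>T = F * M\<^sup>T * F\<^sup>T"
  using F M transpose_mult[of "F * M" n d "F\<^sup>T" n] transpose_mult[OF F M]
    assoc_mult_mat[of F n d "M\<^sup>T" d "F\<^sup>T" n] by simp

text \<open>Products of the two matrices in either order equal \<open>F F^T\<close>, a symmetric
  projector that fixes both of them.\<close>

lemma mp_inverse_sandwich:
  fixes F :: "real mat"
  assumes F: "F \<in> carrier_mat n d" "F\<^sup>T * F = 1\<^sub>m d"
    and M: "M \<in> carrier_mat d d" and N: "N \<in> carrier_mat d d"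
    and inv: "M * N = 1\<^sub>m d" "N * M = 1\<^sub>m d"
  shows "mp_inverse (F * M * F\<^sup>T) = F * N * F\<^sup>T"
proof (rule mp_inverse_eqI)
  have one: "1\<^sub>m d \<in> carrier_mat d d" by simp
  show "is_mp_inverse (F * M * F\<^sup>T) (F * N * F\<^sup>T)"
    unfolding is_mp_inverse_def sandwich_mult[OF F M N] sandwich_mult[OF F N M] inv
      sandwich_mult[OF F one M] sandwich_mult[OF F one N] sandwich_transpose[OF F(1) one]
      left_mult_one_mat[OF M] left_mult_one_mat[OF N] transpose_one
    using F(1) M N by auto
qed

text \<open>With \<open>F\<close> the leading columns of \<open>S\<close>,
  \<open>W = F D F^T\<close> and \<open>F = W F D'\<close>, where \<open>D'\<close> inverts
  \<open>D\<close>. So \<open>W\<close> and \<open>F\<close> have the same column space, hence the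
  same rank.\<close>

lemma mat_rank_diagonalized:
  assumes S: "S \<in> carrier_mat n n" "S\<^sup>T * S = 1\<^sub>m n" and d: "d \<le> n"
    and nonzero: "\<And>i. i < d \<Longrightarrow> lam i \<noteq> 0"
    and zero: "\<And>i. d \<le> i \<Longrightarrow> i < n \<Longrightarrow> lam i = 0"
  shows "mat_rank (S * mat_diag n lam * S\<^sup>T) = d"
proof -
  define F where "F = mat_of_cols n (take d (cols S))"
  have F: "F \<in> carrier_mat n d"
    unfolding F_def using S(1) d by (intro carrier_matI) simp_all
  have FT: "F\<^sup>T \<in> carrier_mat d n" using F by simp
  have FF: "F\<^sup>T * F = 1\<^sub>m d"
    unfolding F_def by (rule leading_cols_orthonormal[OF S d])
  let ?D = "mat_diag d lam" and ?D' = "mat_diag d (\<lambda>i. 1 / lam i)"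
  define W where "W = F * ?D * F\<^sup>T"
  have W_eq: "S * mat_diag n lam * S\<^sup>T = W"
    unfolding W_def F_def by (rule diagonalized_leading_cols[OF S(1) d zero])
  have D: "?D \<in> carrier_mat d d" "?D' \<in> carrier_mat d d" by simp_all
  have FD: "F * ?D \<in> carrier_mat n d" "F * ?D' \<in> carrier_mat n d" using F by auto
  have W: "W \<in> carrier_mat n n" unfolding W_def using FD FT by auto
  have "W = F * (?D * F\<^sup>T)" unfolding W_def by (rule assoc_mult_mat[OF F D(1) FT])
  hence "column_space W \<subseteq> column_space F"
    using column_space_subset_iff[OF W F] mult_carrier_mat[OF D(1) FT] by blast
  moreover have "F = W * (F * ?D')"
  proof -
    have "W * (F * ?D') = F * ?D * ?D'"
      unfolding W_def using assoc_mult_mat[OF FD(1) FT FD(2)] mult_inverse_cancel[OF FF D(2) FT F] by simp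
    also have "\<dots> = F * (?D * ?D')" by (rule assoc_mult_mat[OF F D])
    also have "?D * ?D' = 1\<^sub>m d"
      using nonzero by (subst mat_diag_diag) (intro eq_matI, auto simp: mat_diag_def)
    finally show ?thesis using F by simp
  qed
  hence "column_space F \<subseteq> column_space W"
    using column_space_subset_iff[OF F W] FD(2) by blast
  ultimately have "mat_rank W = mat_rank F" by (intro mat_rank_cong[OF W F]) auto
  then show ?thesis unfolding W_eq using mat_rank_orthonormal_cols[OF F FF] by simp
qed

section \<open>The square root and the factor of a weight matrix\<close>

lemma
  assumes "nonneg_definite n W"
  shows nonneg_definite_mat_sqrt: "nonneg_definite n (mat_sqrt W)"
    and mat_sqrt_square: "mat_sqrt W * mat_sqrt W = W"
    and column_space_mat_sqrt_subset: "column_space (mat_sqrt W) \<subseteq> column_space W"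
proof -
  obtain S lam where S: "S \<in> carrier_mat n n" "S\<^sup>T * S = 1\<^sub>m n" "S * S\<^sup>T = 1\<^sub>m n"
    and W: "W = S * mat_diag n lam * S\<^sup>T" and lam: "\<And>i. i < n \<Longrightarrow> 0 \<le> lam i"
    using nonneg_definite_diagonalization[OF assms] by blast
  have R: "mat_sqrt W = S * mat_diag n (\<lambda>i. sqrt (lam i)) * S\<^sup>T"
    unfolding W by (rule mat_sqrt_diagonalized[OF S(1,2) lam])
  show "nonneg_definite n (mat_sqrt W)"
    unfolding R using nonneg_definite_diagonalized[OF S(1,2) refl] lam by simp
  have "mat_diag n (\<lambda>i. sqrt (lam i) * sqrt (lam i)) = mat_diag n lam"
    using lam unfolding mat_diag_def by (intro eq_matI) auto
  then show "mat_sqrt W * mat_sqrt W = W"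
    unfolding R unfolding W sandwich_mult[OF S(1,2) mat_diag_dim mat_diag_dim] by simp
  \<comment> \<open>Division by zero yields 0, so
    \<open>lam i * (1 / sqrt (lam i)) = sqrt (lam i)\<close> also for a zero eigenvalue, and
    \<open>Z\<close> satisfies \<open>W Z = mat_sqrt W\<close>.\<close>
  define Z where "Z = S * mat_diag n (\<lambda>i. 1 / sqrt (lam i)) * S\<^sup>T"
  have c: "S * mat_diag n f * S\<^sup>T \<in> carrier_mat n n" for f
    using S(1) mult_carrier_mat[of "S * mat_diag n f" n n "S\<^sup>T" n] mult_carrier_mat[of S n n "mat_diag n f" n] by simp
  have "mat_diag n (\<lambda>i. lam i * (1 / sqrt (lam i))) = mat_diag n (\<lambda>i. sqrt (lam i))"
    using lam unfolding mat_diag_def by (intro eq_matI) (auto simp: real_div_sqrt)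
  hence "W * Z = S * mat_diag n (\<lambda>i. sqrt (lam i)) * S\<^sup>T"
    unfolding Z_def W by (subst sandwich_mult[OF S(1,2)]) simp_all
  hence "mat_sqrt W = W * Z" unfolding R ..
  moreover have "Z \<in> carrier_mat n n" "mat_sqrt W \<in> carrier_mat n n" "W \<in> carrier_mat n n"
    unfolding Z_def R using c W by auto
  ultimately show "column_space (mat_sqrt W) \<subseteq> column_space W"
    using column_space_subset_iff by blast
qed

text \<open>Supplies the link \<open>mat_sqrt W = K F^T\<close> between the root and the factor
  \<open>K\<close>. The numbers \<open>s i\<close> are the square roots of the positive
  eigenvalues.\<close>

lemma weight_factor_decomposition:
  assumes W: "nonneg_definite n W" and spec: "spectral_decomposition W S lam"
  obtains F s where "F = mat_of_cols n (take (mat_rank W) (cols S))"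
    "S \<in> carrier_mat n n" "S\<^sup>T * S = 1\<^sub>m n" "S * S\<^sup>T = 1\<^sub>m n" "mat_rank W \<le> n"
    "\<forall>i<mat_rank W. s i \<noteq> 0"
    "weight_factor W S lam = F * mat_diag (mat_rank W) s"
    "mat_sqrt W = F * mat_diag (mat_rank W) s * F\<^sup>T"
proof -
  have n: "dim_row W = n" using W unfolding nonneg_definite_def by auto
  have S: "S \<in> carrier_mat n n" "S\<^sup>T * S = 1\<^sub>m n" "S * S\<^sup>T = 1\<^sub>m n"
    and mono: "\<And>i j. i \<le> j \<Longrightarrow> j < n \<Longrightarrow> lam j \<le> lam i"
    and dec: "W = S * mat_diag n lam * S\<^sup>T"
    using spec unfolding spectral_decomposition_def Let_def n inverts_mat_def by auto
  have nonneg: "\<And>i. i < n \<Longrightarrow> 0 \<le> lam i"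
    using W nonneg_definite_diagonalized[OF S(1,2) dec] by blast
  \<comment> \<open>The first index with eigenvalue 0, or \<open>n\<close> if there is none. As the
    eigenvalues are decreasing and nonnegative, all from \<open>r\<close> on vanish, so
    \<open>r\<close> is the rank.\<close>
  define r where "r = (LEAST i. i = n \<or> lam i = 0)"
  have r_prop: "r = n \<or> lam r = 0" unfolding r_def by (rule LeastI[of _ n]) simp
  have rn: "r \<le> n" unfolding r_def by (rule Least_le) simp
  have pos: "lam i \<noteq> 0" if "i < r" for i
    using not_less_Least[of i "\<lambda>i. i = n \<or> lam i = 0"] that unfolding r_def by blast
  have zero: "lam i = 0" if "r \<le> i" "i < n" for i
    using r_prop mono[OF that] nonneg[OF that(2)] that by auto
  have rank: "mat_rank W = r"
    unfolding dec by (rule mat_rank_diagonalized[OF S(1,2) rn pos zero])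
  let ?s = "\<lambda>i. sqrt (lam i)"
  define F where "F = mat_of_cols n (take r (cols S))"
  \<comment> \<open>A diagonal matrix is diagonalized by the identity.\<close>
  have "mat_sqrt (1\<^sub>m r * mat_diag r lam * (1\<^sub>m r)\<^sup>T) = 1\<^sub>m r * mat_diag r ?s * (1\<^sub>m r)\<^sup>T"
    using rn nonneg by (intro mat_sqrt_diagonalized) auto
  hence "mat_sqrt (mat_diag r lam) = mat_diag r ?s" by simp
  hence 1: "weight_factor W S lam = F * mat_diag r ?s"
    unfolding weight_factor_def Let_def rank n F_def by simp
  have "mat_sqrt W = S * mat_diag n ?s * S\<^sup>T"
    unfolding dec by (rule mat_sqrt_diagonalized[OF S(1,2) nonneg])
  also have "\<dots> = F * mat_diag r ?s * F\<^sup>T"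
    unfolding F_def by (rule diagonalized_leading_cols[OF S(1) rn]) (simp add: zero)
  finally have 2: "mat_sqrt W = F * mat_diag r ?s * F\<^sup>T" .
  show thesis
    by (rule that[of F ?s]) (use S rn pos 1 2 rank F_def in auto)
qed

section \<open>Invertibility and comparison of the two information matrices\<close>

lemma nonsingular_inverse:
  fixes M :: "'a::field mat"
  assumes M: "M \<in> carrier_mat n n"
    and ker: "\<And>x. x \<in> carrier_vec n \<Longrightarrow> M *\<^sub>v x = 0\<^sub>v n \<Longrightarrow> x = 0\<^sub>v n"
  shows "the (mat_inverse M) \<in> carrier_mat n n"
    "M * the (mat_inverse M) = 1\<^sub>m n" "the (mat_inverse M) * M = 1\<^sub>m n"
proof -
  have "det M \<noteq> 0" using det_0_iff_vec_prod_zero_field[OF M] ker by blast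
  hence "M \<in> Units (ring_mat TYPE('a) n undefined)" by (rule det_non_zero_imp_unit[OF M])
  then obtain N where "mat_inverse M = Some N" using mat_inverse(1)[OF M] by fastforce
  with mat_inverse(2)[OF M this]
  show "the (mat_inverse M) \<in> carrier_mat n n"
    "M * the (mat_inverse M) = 1\<^sub>m n" "the (mat_inverse M) * M = 1\<^sub>m n" by auto
qed

lemma gram_kernel:
  fixes B :: "real mat"
  assumes B: "B \<in> carrier_mat k n" and x: "x \<in> carrier_vec n" and zero: "(B\<^sup>T * B) *\<^sub>v x = 0\<^sub>v n"
  shows "B *\<^sub>v x = 0\<^sub>v k"
  using quadratic_form_gram[OF B x] scalar_prod_self_eq_0[of "B *\<^sub>v x"] B x unfolding zero by simp

text \<open>\<open>C G C = C\<close> absorbs \<open>G\<close>. The right side does not mention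
  \<open>G\<close>, so the value is independent of the generalized inverse chosen.\<close>

lemma generalized_inverse_sandwich:
  assumes C: "C \<in> carrier_mat n n" "C\<^sup>T = C" and G: "is_generalized_inverse C G"
    and Z: "Z \<in> carrier_mat n m"
  shows "(C * Z)\<^sup>T * G * (C * Z) = Z\<^sup>T * (C * Z)"
proof -
  have Gc: "G \<in> carrier_mat n n" and CGC: "C * G * C = C"
    using G C unfolding is_generalized_inverse_def by auto
  have ZT: "Z\<^sup>T \<in> carrier_mat m n" and CZ: "C * Z \<in> carrier_mat n m"
    and CG: "C * G \<in> carrier_mat n n" using Z C Gc by auto
  have "(C * Z)\<^sup>T * G * (C * Z) = Z\<^sup>T * (C * G) * (C * Z)"
    using transpose_mult[OF C(1) Z] C(2) assoc_mult_mat[OF ZT C(1) Gc] by simp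
  also have "\<dots> = Z\<^sup>T * (C * G * (C * Z))" by (rule assoc_mult_mat[OF ZT CG CZ])
  also have "C * G * (C * Z) = C * Z" using assoc_mult_mat[OF CG C(1) Z] CGC by simp
  finally show ?thesis .
qed

text \<open>The generalized inverses \<open>G\<close> and \<open>H\<close> may differ, so each
  information matrix can be formed with its own choice. Invertibility of \<open>K^T G K\<close>
  comes first, since the Moore-Penrose inverse is built from its two-sided inverse.\<close>

lemma information_matrices_sandwich:
  fixes B F :: "real mat"
  assumes B: "B \<in> carrier_mat k n" and C: "C = B\<^sup>T * B"
    and F: "F \<in> carrier_mat n d" "F\<^sup>T * F = 1\<^sub>m d"
    and s: "\<forall>i<d. s i \<noteq> 0"
    and K: "K = F * mat_diag d s" and R: "R = K * F\<^sup>T"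
    and sub: "column_space R \<subseteq> column_space C"
    and G: "is_generalized_inverse C G" and H: "is_generalized_inverse C H"
    and sym: "R\<^sup>T = R"
  shows "weighted_info_matrix K G \<in> carrier_mat d d"
    "(K\<^sup>T * G * K) \<in> carrier_mat d d"
    "(K\<^sup>T * G * K) * weighted_info_matrix K G = 1\<^sub>m d"
    "weighted_info_matrix K G * (K\<^sup>T * G * K) = 1\<^sub>m d"
    "system_info_matrix R H = F * weighted_info_matrix K G * F\<^sup>T"
proof -
  have Cc: "C \<in> carrier_mat n n" "C\<^sup>T = C"
    using nonneg_definite_gram[OF B] unfolding nonneg_definite_def C by auto
  have Gc: "G \<in> carrier_mat n n" using G Cc unfolding is_generalized_inverse_def by auto
  have FT: "F\<^sup>T \<in> carrier_mat d n" using F by simp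
  have BT: "B\<^sup>T \<in> carrier_mat n k" using B by simp
  have D: "mat_diag d s \<in> carrier_mat d d" by simp
  have Kc: "K \<in> carrier_mat n d" unfolding K using F by auto
  have KT: "K\<^sup>T \<in> carrier_mat d n" using Kc by simp
  have Rc: "R \<in> carrier_mat n n" unfolding R using Kc FT by auto
  obtain Z where Z: "Z \<in> carrier_mat n n" "R = C * Z"
    using column_space_subset_iff[OF Rc Cc(1)] sub by blast
  have ZF: "Z * F \<in> carrier_mat n d" using Z F by auto
  have RF: "K = R * F"
    unfolding R using assoc_mult_mat[OF Kc FT F(1)] F(2) Kc by simp
  hence KCZF: "K = C * (Z * F)" unfolding Z(2) using assoc_mult_mat[OF Cc(1) Z(1) F(1)] by simp
  \<comment> \<open>Chosen so that both \<open>K = B^T B'\<close> and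
    \<open>K^T G K = B'^T B'\<close>; a kernel vector of the latter is then killed by
    \<open>B'\<close>, hence by \<open>K\<close>.\<close>
  define B' where "B' = B * (Z * F)"
  have B': "B' \<in> carrier_mat k d" unfolding B'_def using B ZF by auto
  have K_B': "K = B\<^sup>T * B'"
    unfolding KCZF C B'_def by (rule assoc_mult_mat[OF BT B ZF])
  define M where "M = K\<^sup>T * G * K"
  show M: "K\<^sup>T * G * K \<in> carrier_mat d d" using KT Gc Kc by auto
  have "M = (Z * F)\<^sup>T * K"
    unfolding M_def KCZF by (rule generalized_inverse_sandwich[OF Cc G ZF])
  also have "\<dots> = (Z * F)\<^sup>T * B\<^sup>T * B'"
    unfolding K_B' using ZF BT B' by (intro assoc_mult_mat[symmetric, of _ d n _ k _ d]) auto
  also have "(Z * F)\<^sup>T * B\<^sup>T = B'\<^sup>T" unfolding B'_def using transpose_mult[OF B ZF] by simp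
  finally have M_gram: "M = B'\<^sup>T * B'" .
  have ker: "x = 0\<^sub>v d" if x: "x \<in> carrier_vec d" and Mx: "M *\<^sub>v x = 0\<^sub>v d" for x
  proof -
    have "B' *\<^sub>v x = 0\<^sub>v k" using gram_kernel[OF B' x] Mx unfolding M_gram by simp
    hence Kx: "K *\<^sub>v x = 0\<^sub>v n"
      unfolding K_B' using assoc_mult_mat_vec[OF BT B' x] BT by auto
    have "F\<^sup>T * K = mat_diag d s" unfolding K by (rule mult_inverse_cancel[OF F(2) D FT F(1)])
    hence Dx: "mat_diag d s *\<^sub>v x = 0\<^sub>v d"
      using assoc_mult_mat_vec[OF FT Kc x] Kx FT by auto
    have "x $ i = 0" if i: "i < d" for i
    proof -
      have "row (mat_diag d s) i = s i \<cdot>\<^sub>v unit_vec d i"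
        using i by (intro eq_vecI) (auto simp: mat_diag_def)
      hence "(mat_diag d s *\<^sub>v x) $ i = s i * x $ i" using i x by simp
      then show ?thesis using s i unfolding Dx by simp
    qed
    then show ?thesis using x by (intro eq_vecI) auto
  qed
  have "K\<^sup>T * G * K *\<^sub>v x = 0\<^sub>v d \<Longrightarrow> x = 0\<^sub>v d" if "x \<in> carrier_vec d" for x
    using ker[OF that] unfolding M_def .
  note inv = nonsingular_inverse[OF M this, folded weighted_info_matrix_def]
  show N: "weighted_info_matrix K G \<in> carrier_mat d d"
    and MN: "(K\<^sup>T * G * K) * weighted_info_matrix K G = 1\<^sub>m d"
    and NM: "weighted_info_matrix K G * (K\<^sup>T * G * K) = 1\<^sub>m d"
    using inv by auto
  \<comment> \<open>Exchanges \<open>H\<close> for \<open>G\<close>: since \<open>R = C Z\<close>,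
    both sides equal \<open>Z^T C Z\<close>.\<close>
  have "R\<^sup>T * H * R = R\<^sup>T * G * R"
    unfolding Z(2) generalized_inverse_sandwich[OF Cc H Z(1)] generalized_inverse_sandwich[OF Cc G Z(1)] ..
  also have "\<dots> = F * K\<^sup>T * G * R"
    using transpose_mult[OF Kc FT] unfolding R[symmetric] by simp
  also have "\<dots> = F * (K\<^sup>T * G) * R" using assoc_mult_mat[OF F(1) KT Gc] by simp
  also have "\<dots> = F * (K\<^sup>T * G) * K * F\<^sup>T"
    unfolding R using F KT Gc Kc FT by (intro assoc_mult_mat[symmetric, of _ n n _ d _ n]) auto
  also have "F * (K\<^sup>T * G) * K = F * (K\<^sup>T * G * K)"
    using F KT Gc Kc by (intro assoc_mult_mat[of _ n d _ n _ d]) auto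
  finally show "system_info_matrix R H = F * weighted_info_matrix K G * F\<^sup>T"
    unfolding system_info_matrix_def using mp_inverse_sandwich[OF F M N MN NM] by simp
qed

text \<open>The two matrices have sizes \<open>v\<close> and \<open>mat_rank W\<close>, so agreement
  of their spectra concerns the nonzero eigenvalues: the larger matrix has exactly
  \<open>v - mat_rank W\<close> additional zeros, and 0 is not an eigenvalue of the smaller
  one.\<close>

theorem theorem4:
  fixes n v m :: nat
    and Xi :: "'design set"
    and X :: "'design \<Rightarrow> real mat"
    and L GL W :: "real mat"
    and E :: "real vec set"
  assumes "\<And>\<xi>. \<xi> \<in> Xi \<Longrightarrow> X \<xi> \<in> carrier_mat n v"
    and "L \<in> carrier_mat n m"
    and "is_generalized_inverse (L\<^sup>T * L) GL"
    and "VectorSpace.subspace class_ring E (module_vec TYPE(real) v)"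
    and "\<And>\<xi>. \<xi> \<in> Xi \<Longrightarrow> column_space (info_matrix L GL (X \<xi>)) = E"
    and "is_weight_matrix v E W"
  shows "estimable_system v E (mat_sqrt W) \<and>
    corresponding_weight_matrix (mat_sqrt W) = W \<and>
    (\<forall>\<xi> \<in> Xi. feasible (info_matrix L GL (X \<xi>)) (mat_sqrt W) \<longrightarrow>
      (\<forall>S lam G H.
         spectral_decomposition W S lam \<longrightarrow>
         is_generalized_inverse (info_matrix L GL (X \<xi>)) G \<longrightarrow>
         is_generalized_inverse (info_matrix L GL (X \<xi>)) H \<longrightarrow>
         column_space W \<subseteq> column_space (info_matrix L GL (X \<xi>)) \<and>
         invertible_mat ((weight_factor W S lam)\<^sup>T * G * weight_factor W S lam) \<and>
         0 \<notin># eigenvalue_mset (weighted_info_matrix (weight_factor W S lam) G) \<and>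
         eigenvalue_mset (system_info_matrix (mat_sqrt W) H) =
           eigenvalue_mset (weighted_info_matrix (weight_factor W S lam) G)
           + replicate_mset (v - mat_rank W) 0))"
proof -
  let ?R = "mat_sqrt W"
  have W: "nonneg_definite v W" and WE: "column_space W \<subseteq> E"
    using assms(6) unfolding is_weight_matrix_def by auto
  have R: "?R \<in> carrier_mat v v" "?R\<^sup>T = ?R" using nonneg_definite_mat_sqrt[OF W] unfolding nonneg_definite_def by auto
  have "estimable_system v E ?R" using R column_space_mat_sqrt_subset[OF W] WE unfolding estimable_system_def by auto
  moreover have "corresponding_weight_matrix ?R = W"
    unfolding corresponding_weight_matrix_def R(2) by (rule mat_sqrt_square[OF W])
  moreover have "column_space W \<subseteq> column_space C \<and> invertible_mat (K\<^sup>T * G * K) \<and>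
      0 \<notin># eigenvalue_mset (weighted_info_matrix K G) \<and>
      eigenvalue_mset (system_info_matrix ?R H) =
        eigenvalue_mset (weighted_info_matrix K G) + replicate_mset (v - mat_rank W) 0"
    if \<xi>: "\<xi> \<in> Xi" and C: "C = info_matrix L GL (X \<xi>)" and feas: "feasible C ?R"
      and spec: "spectral_decomposition W S lam" and K: "K = weight_factor W S lam"
      and G: "is_generalized_inverse C G" and H: "is_generalized_inverse C H"
    for \<xi> C S lam K G H
  proof -
    define d where "d = mat_rank W"
    obtain F s where F_eq: "F = mat_of_cols v (take d (cols S))"
      and S: "S \<in> carrier_mat v v" "S\<^sup>T * S = 1\<^sub>m v" "S * S\<^sup>T = 1\<^sub>m v" and d: "d \<le> v"
      and s: "\<forall>i<d. s i \<noteq> 0" and K_eq: "K = F * mat_diag d s"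
      and R_eq: "?R = F * mat_diag d s * F\<^sup>T"
      using weight_factor_decomposition[OF W spec] unfolding d_def K by blast
    have F: "F \<in> carrier_mat v d" unfolding F_eq using S(1) d by (intro carrier_matI) simp_all
    have FF: "F\<^sup>T * F = 1\<^sub>m d" unfolding F_eq by (rule leading_cols_orthonormal[OF S(1,2) d])
    obtain B where B: "B \<in> carrier_mat n v" "C = B\<^sup>T * B"
      using info_matrix_gram[OF assms(1)[OF \<xi>] assms(2,3)] C by metis
    have sub: "column_space ?R \<subseteq> column_space C" using feas unfolding feasible_def by blast
    note info = information_matrices_sandwich[OF B F FF s K_eq R_eq[folded K_eq] sub G H R(2)]
    let ?N = "weighted_info_matrix K G"
    have "column_space W \<subseteq> column_space C" using WE assms(5)[OF \<xi>] unfolding C by simp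
    moreover have "invertible_mat (K\<^sup>T * G * K)"
      
      unfolding invertible_mat_def inverts_mat_def square_mat.simps
      using carrier_matD[OF info(1)] carrier_matD[OF info(2)] info(3,4) by metis
    moreover have "0 \<notin># eigenvalue_mset ?N"
      by (rule zero_notin_eigenvalue_mset[OF info(1,4,2)])
    moreover have "eigenvalue_mset (system_info_matrix ?R H) =
        eigenvalue_mset ?N + replicate_mset (v - d) 0"
    proof -
      let ?Z = "zero_padded v d ?N"
      have Z: "?Z \<in> carrier_mat v v"
        using four_block_carrier_mat[OF info(1), of "0\<^sub>m (v - d) (v - d)" "v - d" "v - d"] d by simp
      have eq: "system_info_matrix ?R H = S * ?Z * S\<^sup>T"
        unfolding info(5) F_eq by (rule leading_cols_sandwich[OF S(1) d info(1)])
      have c: "S * ?Z * S\<^sup>T \<in> carrier_mat v v" 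
        using mult_carrier_mat[OF mult_carrier_mat[OF S(1) Z], of "S\<^sup>T" v] S(1) by simp
      \<comment> \<open>\<open>S\<close> is orthogonal, so \<open>S^T\<close> is its inverse and the
        sandwich is a similarity.\<close>
      have "similar_mat (S * ?Z * S\<^sup>T) ?Z"
        by (rule similar_matI[of _ _ S "S\<^sup>T" v]) (use S Z c in auto)
      hence "eigenvalue_mset (S * ?Z * S\<^sup>T) = eigenvalue_mset ?Z"
        unfolding eigenvalue_mset_eq[OF c] eigenvalue_mset_eq[OF Z] by (simp add: char_poly_similar)
      then show ?thesis unfolding eq using eigenvalue_mset_zero_padded[OF d info(1)] by simp
    qed
    ultimately show ?thesis unfolding d_def by blast
  qed
  ultimately show ?thesis by blast
qed

end
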